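(* For every integer $n>3$, let $N$ be the least common multiple of the numbers $2,3,\dots,n$, and let $CT_{(n)}=\langle CT_2,CT_3,\dots,CT_n\rangle$ be the group of permutations of $\mathbb{Z}$ generated by the horizontal class transposition groups $CT_2,\dots,CT_n$. Then $CT_{(n)}\cong S_N$, where $S_N$ is the symmetric group of degree $N$.
   Context: For an integer $m>1$ and $0\le r<m$, the residue class modulo $m$ is $r(m)=\{r+km\mid k\in\mathbb{Z}\}$. For $0\le r_1\ne r_2<m$, the horizontal class transposition $\tau_{r_1(m),r_2(m)}$ is the permutation of $\mathbb{Z}$ that interchanges $r_1+km$ and $r_2+km$ for each $k\in\mathbb{Z}$ and fixes every other integer, i.e. $\tau_{r_1(m),r_2(m)}=\prod_{k\in\mathbb{Z}}(r_1+km,\;r_2+km)$. The horizontal class transposition group $CT_m$ is the subgroup of the group of all permutations of $\mathbb{Z}$ generated by all $\tau_{r_1(m),r_2(m)}$ with $0\le r_1\neq r_2<m$. *)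

theory Defs
  imports "HOL-Algebra.Algebra"
begin

definition residue_class :: "nat \<Rightarrow> nat \<Rightarrow> int set" where
  "residue_class r m = {int r + k * int m | k. True}"

definition horizontal_class_transposition :: "nat \<Rightarrow> nat \<Rightarrow> nat \<Rightarrow> int \<Rightarrow> int" where
  "horizontal_class_transposition m r1 r2 x =
     (if x \<in> residue_class r1 m then x - int r1 + int r2
      else if x \<in> residue_class r2 m then x - int r2 + int r1
      else x)"

lemma residue_class_iff:
  assumes "r < m"
  shows "x \<in> residue_class r m \<longleftrightarrow> x mod int m = int r"
proof
  assume "x \<in> residue_class r m"
  then show "x mod int m = int r"
    using assms by (auto simp: residue_class_def)
next
  assume "x mod int m = int r"
  then have "x = int r + (x div int m) * int m"
    by (metis add.commute div_mult_mod_eq)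
  then show "x \<in> residue_class r m"
    by (auto simp: residue_class_def)
qed

lemma horizontal_class_transposition_apply:
  assumes "r1 < m" "r2 < m" "r1 \<noteq> r2"
  shows "horizontal_class_transposition m r1 r2 (int r1 + k * int m) = int r2 + k * int m"
    and "horizontal_class_transposition m r1 r2 (int r2 + k * int m) = int r1 + k * int m"
    and "x \<notin> residue_class r1 m \<union> residue_class r2 m
           \<Longrightarrow> horizontal_class_transposition m r1 r2 x = x"
  using assms by (auto simp: horizontal_class_transposition_def residue_class_iff)

lemma horizontal_class_transposition_involution:
  assumes "r1 < m" "r2 < m" "r1 \<noteq> r2"
  shows "horizontal_class_transposition m r1 r2 (horizontal_class_transposition m r1 r2 x) = x"
proof -
  consider "x \<in> residue_class r1 m" | "x \<in> residue_class r2 m"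
    | "x \<notin> residue_class r1 m \<union> residue_class r2 m" by blast
  then show ?thesis
    using horizontal_class_transposition_apply[OF assms]
    by cases (auto simp: residue_class_def)
qed

lemma horizontal_class_transposition_in_BijGroup:
  assumes "r1 < m" "r2 < m" "r1 \<noteq> r2"
  shows "horizontal_class_transposition m r1 r2 \<in> carrier (BijGroup UNIV)"
proof -
  have "bij (horizontal_class_transposition m r1 r2)"
    using horizontal_class_transposition_involution[OF assms]
    by (metis bijI')
  then show ?thesis
    by (simp add: BijGroup_def Bij_def)
qed

definition CT :: "nat \<Rightarrow> (int \<Rightarrow> int) monoid" where
  "CT m = subgroup_generated (BijGroup UNIV)
     {horizontal_class_transposition m r1 r2 | r1 r2. r1 < m \<and> r2 < m \<and> r1 \<noteq> r2}"

definition CT_upto :: "nat \<Rightarrow> (int \<Rightarrow> int) monoid" where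
  "CT_upto n = subgroup_generated (BijGroup UNIV) (\<Union>m\<in>{2..n}. carrier (CT m))"

end

theory Submission
  imports Defs
begin

text \<open>
  A horizontal class transposition modulo \<open>m\<close> permutes the residues inside every interval
  \<open>[k m, (k+1) m)\<close> in the same way. Hence \<open>CT\<^sub>m\<close> consists of the periodic extensions
  \<open>periodic m p\<close> of the permutations \<open>p\<close> of \<open>{0..<m}\<close> and is a copy of \<open>S\<^sub>m\<close>, and if \<open>m\<close> divides
  \<open>L\<close>, then \<open>CT\<^sub>m\<close> lies in \<open>CT\<^sub>L\<close>. So \<open>CT\<^sub>(\<^sub>n\<^sub>)\<close> lies in \<open>CT\<^sub>N\<close>, and the content of the theorem is the
  equality of the two groups. It follows by induction on \<open>n\<close> from a statement about two moduli:
  \<open>CT\<^sub>N\<close> and \<open>CT\<^sub>m\<close> generate \<open>CT\<^sub>L\<close> for \<open>L = lcm N m\<close>, provided \<open>m \<ge> 4\<close> and \<open>N \<ge> m + 3\<close>, or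
  \<open>N = 4\<close> and \<open>m = 3\<close>. The exceptional pair starts the induction at \<open>n = 4\<close>.

  To prove the two-modulus statement, restrict everything to \<open>{0..<L}\<close>. There
  \<open>S\<^sub>N\<close> and \<open>S\<^sub>m\<close> act diagonally, on the blocks of length \<open>N\<close> and on those of length \<open>m\<close>. The
  group \<open>G\<close> that they generate is all of \<open>S\<^sub>L\<close> for the following reasons.

  \<^item> \<open>G\<close> contains a 3-cycle inside the first \<open>N\<close>-block. It comes from iterated commutators of
    diagonal transpositions: the shifts between \<open>N\<close>-blocks and \<open>m\<close>-blocks differ from block to
    block, so a suitable commutator acts on the first block unlike on any other
    (\<open>three_cycle_mem_of_large_modulus\<close>). For \<open>N = 4\<close>, \<open>m = 3\<close> one computes in \<open>S\<^sub>1\<^sub>2\<close>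
    (\<open>linked_of_moduli_4_3\<close>).
  \<^item> Call \<open>x\<close> and \<open>y\<close> linked if some 3-cycle \<open>(x y z)\<close> lies in \<open>G\<close>. This is a \<open>G\<close>-invariant
    equivalence relation. The action of \<open>S\<^sub>N\<close> links all points of the first block; no interior
    boundary \<open>s N\<close> of \<open>N\<close>-blocks is a multiple of \<open>m\<close>, so an element of \<open>S\<^sub>m\<close> swaps \<open>s N - 1\<close> with
    \<open>s N\<close> and carries links across the boundary. Hence any two points are linked, and then all
    3-cycles, and so all even permutations, are in \<open>G\<close>.
  \<^item> \<open>G\<close> contains an odd permutation: the diagonal transposition from \<open>S\<^sub>N\<close> is a product of
    \<open>L / N\<close> transpositions and the one from \<open>S\<^sub>m\<close> of \<open>L / m\<close>, and these two numbers are coprime.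
\<close>

section \<open>Permutation groups with many 3-cycles\<close>

abbreviation transposition :: "'a \<Rightarrow> 'a \<Rightarrow> 'a \<Rightarrow> 'a" where
  "transposition \<equiv> Transposition.transpose"

definition three_cycle :: "'a \<Rightarrow> 'a \<Rightarrow> 'a \<Rightarrow> 'a \<Rightarrow> 'a" where
  "three_cycle x y z = transposition x y \<circ> transposition y z"

lemma conj_transposition:
  assumes "bij p"
  shows "p \<circ> transposition x y \<circ> inv' p = transposition (p x) (p y)"
proof -
  have i: "inv' p (p u) = u" for u
    using assms by (simp add: bij_is_inj)
  have "transposition (p x) (p y) \<circ> p = p \<circ> transposition x y"
    using transpose_comp_eq[OF assms, of "p x" "p y"] i by simp
  then show ?thesis
    using assms by (metis comp_assoc bij_is_surj surj_iff comp_id)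
qed

lemma conj_three_cycle:
  assumes "bij p"
  shows "p \<circ> three_cycle x y z \<circ> inv' p = three_cycle (p x) (p y) (p z)"
proof -
  have "p \<circ> three_cycle x y z \<circ> inv' p
      = (p \<circ> transposition x y \<circ> inv' p) \<circ> (p \<circ> transposition y z \<circ> inv' p)"
    using assms by (simp add: three_cycle_def fun_eq_iff bij_is_inj)
  then show ?thesis
    by (simp add: conj_transposition[OF assms] three_cycle_def)
qed

lemma three_cycle_rotate:
  "distinct [x, y, z] \<Longrightarrow> three_cycle y z x = three_cycle x y z"
  by (auto simp: three_cycle_def fun_eq_iff Transposition.transpose_def)

lemma inv_three_cycle: "inv' (three_cycle x y z) = three_cycle z y x"
  unfolding three_cycle_def
  by (rule inv_unique_comp) (auto simp: fun_eq_iff transpose_commute)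

lemma three_cycle_apply:
  assumes "distinct [x, y, z]"
  shows "three_cycle x y z x = y" "three_cycle x y z y = z" "three_cycle x y z z = x"
    "u \<notin> {x, y, z} \<Longrightarrow> three_cycle x y z u = u"
  using assms by (auto simp: three_cycle_def Transposition.transpose_def)

text \<open>
  Total functions instead of the extensional ones of \<open>BijGroup A\<close>, so that composition is
  \<open>\<circ>\<close>. For \<open>A = UNIV\<close> these are exactly the subgroups of \<open>BijGroup UNIV\<close>.
\<close>
locale permutation_group =
  fixes A :: "'a set" and G :: "('a \<Rightarrow> 'a) set"
  assumes permutes: "p \<in> G \<Longrightarrow> p permutes A"
    and id_mem: "id \<in> G"
    and comp_mem: "p \<in> G \<Longrightarrow> q \<in> G \<Longrightarrow> p \<circ> q \<in> G"
    and inv_mem: "p \<in> G \<Longrightarrow> inv' p \<in> G"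
begin

lemma conj_transposition_mem:
  assumes "p \<in> G" "transposition x y \<in> G"
  shows "transposition (p x) (p y) \<in> G"
  using conj_transposition[OF permutes_bij[OF permutes[OF assms(1)]], of x y]
    comp_mem[OF comp_mem[OF assms] inv_mem[OF assms(1)]]
  by simp

lemma conj_three_cycle_mem:
  assumes "p \<in> G" "three_cycle x y z \<in> G"
  shows "three_cycle (p x) (p y) (p z) \<in> G"
  using conj_three_cycle[OF permutes_bij[OF permutes[OF assms(1)]], of x y z]
    comp_mem[OF comp_mem[OF assms] inv_mem[OF assms(1)]]
  by simp

text \<open>
  The relation behind Jordan's theorem that a primitive group containing a 3-cycle contains the
  alternating group: it is a \<open>G\<close>-invariant equivalence relation.
\<close>
definition linked :: "'a \<Rightarrow> 'a \<Rightarrow> bool" where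
  "linked x y \<longleftrightarrow> x = y \<or> (\<exists>z. distinct [x, y, z] \<and> three_cycle x y z \<in> G)"

lemma linked_sym: "linked x y \<Longrightarrow> linked y x"
proof -
  assume l: "linked x y"
  { fix z assume "distinct [x, y, z]" "three_cycle x y z \<in> G"
    moreover from this have "three_cycle z y x \<in> G"
      by (metis inv_mem inv_three_cycle)
    ultimately have "three_cycle y x z \<in> G"
      by (metis three_cycle_rotate distinct_length_2_or_more distinct_singleton)
  }
  with l show "linked y x"
    unfolding linked_def by fastforce
qed

lemma linked_image: "linked x y \<Longrightarrow> p \<in> G \<Longrightarrow> linked (p x) (p y)"
proof -
  assume l: "linked x y" and p: "p \<in> G"
  have "inj p"
    using p permutes permutes_inj by blast
  then show "linked (p x) (p y)"
    using l conj_three_cycle_mem[OF p] unfolding linked_def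
    by (auto simp: inj_eq)
       (metis inj_eq)
qed

text \<open>
  Conjugation by \<open>(y w v)\<close> sends \<open>y\<close> to \<open>w\<close> and fixes \<open>x\<close> unless \<open>v = x\<close>, so it turns a link from
  \<open>x\<close> to \<open>y\<close> into one from \<open>x\<close> to \<open>w\<close>. If \<open>v = x\<close>, then \<open>(y w x)\<close> already links \<open>w\<close> to \<open>x\<close>.
\<close>
lemma linked_trans:
  assumes "linked x y" "linked y w"
  shows "linked x w"
proof (cases "x = y \<or> y = w \<or> x = w")
  case True
  then show ?thesis using assms by (auto simp: linked_def)
next
  case False
  then obtain z v where z: "distinct [x, y, z]" "three_cycle x y z \<in> G"
    and v: "distinct [y, w, v]" "three_cycle y w v \<in> G"
    using assms by (auto simp: linked_def)
  show ?thesis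
  proof (cases "v = x")
    case True
    then have "three_cycle w x y \<in> G"
      using v three_cycle_rotate[of y w x] by auto
    then have "linked w x" using v True False by (auto simp: linked_def)
    then show ?thesis by (rule linked_sym)
  next
    case v_x: False
    let ?p = "three_cycle y w v"
    have "linked (?p x) (?p y)"
      using linked_image[OF _ v(2), of x y] z by (auto simp: linked_def)
    moreover have "?p x = x" "?p y = w"
      using v(1) v_x z(1) False by (auto simp: three_cycle_apply)
    ultimately show ?thesis by simp
  qed
qed

text \<open>
  If the link \<open>(z w v)\<close> avoids \<open>x\<close> and \<open>y\<close>, conjugation by it turns \<open>(x y z)\<close> into \<open>(x y w)\<close>.
  Otherwise \<open>v\<close> is \<open>x\<close> or \<open>y\<close>, both 3-cycles live on the four points \<open>x, y, z, w\<close>, and conjugating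
  the link by \<open>(x y z)\<close> or by its inverse gives \<open>(x y w)\<close> up to rotation and inversion.
\<close>
lemma three_cycle_exchange:
  assumes d: "distinct [x, y, z]" and G: "three_cycle x y z \<in> G"
    and l: "linked z w" and w: "w \<notin> {x, y}"
  shows "three_cycle x y w \<in> G"
proof (cases "z = w")
  case True
  then show ?thesis using G by simp
next
  case False
  then obtain v where v: "distinct [z, w, v]" "three_cycle z w v \<in> G"
    using l by (auto simp: linked_def)
  let ?p = "three_cycle x y z"
  consider "v = x" | "v = y" | "v \<notin> {x, y}" by blast
  then show ?thesis
  proof cases
    case 1
    have "three_cycle (?p z) (?p w) (?p x) \<in> G"
      using conj_three_cycle_mem[OF G v(2)] 1 by simp
    moreover have "?p z = x" "?p w = w" "?p x = y"
      using d w False by (auto simp: three_cycle_apply)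
    ultimately have "three_cycle x w y \<in> G" by simp
    then have "three_cycle y w x \<in> G"
      by (metis inv_mem inv_three_cycle)
    then show ?thesis
      using three_cycle_rotate[of y w x] three_cycle_rotate[of w x y] d w by auto
  next
    case 2
    have G': "three_cycle z y x \<in> G"
      using inv_mem[OF G] by (simp add: inv_three_cycle)
    let ?q = "three_cycle z y x"
    have "three_cycle (?q z) (?q w) (?q y) \<in> G"
      using conj_three_cycle_mem[OF G' v(2)] 2 by simp
    moreover have "?q z = y" "?q w = w" "?q y = x"
      using d w False three_cycle_apply[of z y x] by auto
    ultimately have "three_cycle y w x \<in> G" by simp
    then show ?thesis
      using three_cycle_rotate[of y w x] three_cycle_rotate[of w x y] d w by auto
  next
    case 3
    let ?r = "three_cycle z w v"
    have "three_cycle (?r x) (?r y) (?r z) \<in> G"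
      using conj_three_cycle_mem[OF v(2) G] .
    moreover have "?r z = w" "?r x = x" "?r y = y"
      using d w v(1) 3 three_cycle_apply[of z w v] by auto
    ultimately show ?thesis by simp
  qed
qed

lemma three_cycles_mem:
  assumes all: "\<And>x y. x \<in> A \<Longrightarrow> y \<in> A \<Longrightarrow> linked x y"
    and "distinct [x, y, z]" "{x, y, z} \<subseteq> A"
  shows "three_cycle x y z \<in> G"
proof -
  obtain v where v: "distinct [x, y, v]" "three_cycle x y v \<in> G"
    using all[of x y] assms by (auto simp: linked_def)
  have "v \<in> A"
  proof (rule ccontr)
    assume "v \<notin> A"
    then have "three_cycle x y v v = v"
      using permutes[OF v(2)] by (simp add: permutes_not_in)
    then show False using v(1) three_cycle_apply(3)[of x y v] by auto
  qed
  then show ?thesis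
    using three_cycle_exchange[OF v all[of v z]] assms by auto
qed

lemma transposition_pair_mem:
  assumes all: "\<And>x y. x \<in> A \<Longrightarrow> y \<in> A \<Longrightarrow> linked x y"
    and A: "{a, b, c, d} \<subseteq> A" and "a \<noteq> b" "c \<noteq> d"
  shows "transposition a b \<circ> transposition c d \<in> G"
proof -
  have shared: "transposition u v \<circ> transposition v w \<in> G"
    if "{u, v, w} \<subseteq> A" "u \<noteq> v" "v \<noteq> w" for u v w
  proof (cases "u = w")
    case True
    then show ?thesis using id_mem by (simp add: transpose_commute[of w v])
  next
    case False
    then show ?thesis
      using three_cycles_mem[OF all, of u v w] that by (simp add: three_cycle_def)
  qed
  show ?thesis
  proof (cases "b = c")
    case True
    then show ?thesis using shared[of a b d] assms by simp
  next
    case False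
    \<comment> \<open>Inserting \<open>(b c)(b c)\<close> gives two pairs that share a point.\<close>
    have "(transposition a b \<circ> transposition b c) \<circ> (transposition b c \<circ> transposition c d) \<in> G"
      using comp_mem[OF shared[of a b c] shared[of b c d]] assms False by simp
    then show ?thesis
      by (simp add: fun_eq_iff comp_def)
  qed
qed

text \<open>
  Products of two transpositions are products of 3-cycles, so the even permutations are in \<open>G\<close>;
  since they have index 2, a single odd element gives the rest.
\<close>
lemma eq_symmetric_group:
  assumes fin: "finite A"
    and all: "\<And>x y. x \<in> A \<Longrightarrow> y \<in> A \<Longrightarrow> linked x y"
    and odd: "q \<in> G" "\<not> evenperm q"
  shows "G = {p. p permutes A}"
proof -
  have even: "p \<in> G" if "p permutes A" "evenperm p" for p
  proof -
    have "(evenperm p \<longrightarrow> p \<in> G) \<and>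
      (\<not> evenperm p \<longrightarrow> (\<forall>a\<in>A. \<forall>b\<in>A. a \<noteq> b \<longrightarrow> transposition a b \<circ> p \<in> G))"
      using that(1) fin
    proof (induction rule: permutes_induct)
      case id
      then show ?case using id_mem by (simp add: id_def)
    next
      case (swap a b p)
      have ev: "evenperm (transposition a b \<circ> p) \<longleftrightarrow> \<not> evenperm p"
        using swap fin
        by (simp add: evenperm_comp evenperm_swap permutation_swap_id permutes_imp_permutation[of A])
      have "transposition c d \<circ> (transposition a b \<circ> p) \<in> G"
        if "p \<in> G" "c \<in> A" "d \<in> A" "c \<noteq> d" for c d
        using comp_mem[OF transposition_pair_mem[OF all, of c d a b] \<open>p \<in> G\<close>] swap that
        by (simp add: comp_assoc)
      with swap ev show ?case by blast
    qed
    with that show ?thesis by blast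
  qed
  have "p \<in> G" if p: "p permutes A" for p
  proof (cases "evenperm p")
    case True
    with p show ?thesis by (rule even)
  next
    case False
    have q: "q permutes A" by (rule permutes) (rule odd)
    have "p \<circ> inv' q \<in> G"
    proof (rule even)
      show "p \<circ> inv' q permutes A"
        using p q by (simp add: permutes_compose permutes_inv)
      have "permutation p" "permutation q" "permutation (inv' q)"
        using p q fin by (auto intro: permutes_imp_permutation permutes_inv)
      then show "evenperm (p \<circ> inv' q)"
        using False odd(2) by (simp add: evenperm_comp evenperm_inv)
    qed
    from comp_mem[OF this odd(1)] show ?thesis
      by (simp add: comp_assoc permutes_inv_o(2)[OF q])
  qed
  then show ?thesis using permutes by blast
qed

end

section \<open>Periodic and blockwise extensions of permutations\<close>

definition periodic :: "int \<Rightarrow> (int \<Rightarrow> int) \<Rightarrow> int \<Rightarrow> int" where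
  "periodic m p x = m * (x div m) + p (x mod m)"

text \<open>
  The restriction of the periodic extension to an interval \<open>{0..<L}\<close>, extended by the identity so
  that it is a permutation of that interval in the sense of \<open>permutes\<close>. It is meant for \<open>m\<close>
  dividing \<open>L\<close>, where it is the diagonal action of \<open>S\<^sub>m\<close> on \<open>L / m\<close> blocks.
\<close>
definition blockwise :: "int \<Rightarrow> int \<Rightarrow> (int \<Rightarrow> int) \<Rightarrow> int \<Rightarrow> int" where
  "blockwise L m p x = (if x \<in> {0..<L} then periodic m p x else x)"

lemma periodic_div_mod:
  assumes "0 < m" "p permutes {0..<m}"
  shows "periodic m p x div m = x div m" "periodic m p x mod m = p (x mod m)"
proof -
  have "p (x mod m) \<in> {0..<m}"
    using assms(1) by (simp only: permutes_in_image[OF assms(2)]) simp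
  then show "periodic m p x div m = x div m" "periodic m p x mod m = p (x mod m)"
    using assms(1) by (simp_all add: periodic_def)
qed

lemma periodic_comp:
  assumes "0 < m" "q permutes {0..<m}"
  shows "periodic m (p \<circ> q) = periodic m p \<circ> periodic m q"
proof
  fix x
  have "(periodic m p \<circ> periodic m q) x
      = m * (periodic m q x div m) + p (periodic m q x mod m)"
    by (simp add: periodic_def)
  then show "periodic m (p \<circ> q) x = (periodic m p \<circ> periodic m q) x"
    by (simp only: periodic_div_mod[OF assms]) (simp add: periodic_def)
qed

lemma periodic_id: "periodic m id = id"
  by (simp add: periodic_def fun_eq_iff)

lemma inv_periodic:
  assumes "0 < m" "p permutes {0..<m}"
  shows "inv' (periodic m p) = periodic m (inv' p)"
  by (rule inv_unique_comp)
     (simp_all add: periodic_comp[symmetric] assms permutes_inv permutes_inv_o[OF assms(2)] periodic_id)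

lemma bij_periodic:
  assumes "0 < m" "p permutes {0..<m}"
  shows "bij (periodic m p)"
  by (rule o_bij[of "periodic m (inv' p)"])
     (simp_all add: periodic_comp[symmetric] assms permutes_inv permutes_inv_o[OF assms(2)] periodic_id)

lemma periodic_transposition:
  "periodic m (transposition i j) x
    = (if x mod m = i then x - i + j else if x mod m = j then x - j + i else x)"
proof -
  have "m * (x div m) = x - x mod m"
    by (simp add: minus_mod_eq_mult_div)
  then show ?thesis
    by (simp add: periodic_def Transposition.transpose_def)
qed

lemma periodic_in_interval:
  assumes "0 < m" "m dvd L" "p permutes {0..<m}"
  shows "periodic m p x \<in> {0..<L} \<longleftrightarrow> x \<in> {0..<L}"
proof -
  obtain k where k: "L = m * k" using assms by auto
  have "y \<in> {0..<L} \<longleftrightarrow> y div m \<in> {0..<k}" for y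
  proof -
    have "k \<le> y div m \<longleftrightarrow> m * k \<le> y"
    proof
      assume "k \<le> y div m"
      then have "m * k \<le> m * (y div m)"
        using assms(1) by simp
      then show "m * k \<le> y"
        using assms(1) by (smt (verit) minus_mod_eq_mult_div pos_mod_sign)
    next
      assume "m * k \<le> y"
      then show "k \<le> y div m"
        using assms(1) by (metis nonzero_mult_div_cancel_left less_irrefl zdiv_mono1)
    qed
    then show ?thesis
      using assms(1) by (auto simp: k pos_imp_zdiv_nonneg_iff)
  qed
  then show ?thesis
    by (simp add: periodic_div_mod[OF assms(1,3)])
qed

lemma transposition_permutes: "a \<in> A \<Longrightarrow> b \<in> A \<Longrightarrow> transposition a b permutes A"
  by (rule permutes_swap_id)

lemma blockwise_permutes:
  assumes "0 < m" "m dvd L" "p permutes {0..<m}"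
  shows "blockwise L m p permutes {0..<L}"
proof (rule inj_imp_permutes)
  show "inj_on (blockwise L m p) {0..<L}"
    using bij_periodic[OF assms(1,3)] unfolding blockwise_def
    by (auto simp: inj_on_def bij_def)
  show "blockwise L m p x \<in> {0..<L}" if "x \<in> {0..<L}" for x
    using that periodic_in_interval[OF assms, of x] by (simp add: blockwise_def)
qed (auto simp: blockwise_def)

lemma blockwise_comp:
  assumes "0 < m" "m dvd L" "q permutes {0..<m}"
  shows "blockwise L m (p \<circ> q) = blockwise L m p \<circ> blockwise L m q"
proof
  fix x
  show "blockwise L m (p \<circ> q) x = (blockwise L m p \<circ> blockwise L m q) x"
  proof (cases "x \<in> {0..<L}")
    case True
    then have "periodic m q x \<in> {0..<L}"
      using periodic_in_interval[OF assms] by blast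
    then show ?thesis
      by (simp only: blockwise_def True if_True comp_apply periodic_comp[OF assms(1,3)])
  next
    case False
    then show ?thesis by (simp only: blockwise_def if_False comp_apply)
  qed
qed

lemma blockwise_id: "blockwise L m id = id"
  by (simp add: blockwise_def periodic_id fun_eq_iff)

lemma blockwise_transposition:
  "blockwise L m (transposition i j) x
    = (if x \<notin> {0..<L} then x else if x mod m = i then x - i + j
       else if x mod m = j then x - j + i else x)"
  by (simp add: blockwise_def periodic_transposition)

lemma blockwise_transposition_involutory:
  assumes "0 < m" "m dvd L" "{i, j} \<subseteq> {0..<m}"
  shows "blockwise L m (transposition i j) (blockwise L m (transposition i j) x) = x"
proof -
  have "transposition i j permutes {0..<m}"
    using assms(3) by (intro transposition_permutes) auto
  from blockwise_comp[OF assms(1,2) this, of "transposition i j"]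
  show ?thesis
    unfolding transpose_comp_involutory blockwise_id
    by (metis comp_apply id_apply)
qed

lemma periodic_blockwise:
  assumes "0 < m" "0 < L" "m dvd L"
  shows "periodic L (blockwise L m p) = periodic m p"
proof
  fix x
  obtain k where k: "L = m * k" using assms by auto
  have "x = x mod L + m * (k * (x div L))"
    by (simp add: k mult.assoc[symmetric])
  then have "x div m = (x mod L + m * (k * (x div L))) div m"
    by (rule arg_cong)
  also have "\<dots> = x mod L div m + k * (x div L)"
    using assms(1) by simp
  finally have "m * (x div m) = L * (x div L) + m * (x mod L div m)"
    by (simp only: k) (simp only: distrib_left mult.assoc add.commute)
  moreover have "x mod L mod m = x mod m"
    using assms(3) by (rule mod_mod_cancel)
  moreover have "x mod L \<in> {0..<L}"
    using assms(2) by simp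
  ultimately show "periodic L (blockwise L m p) x = periodic m p x"
    by (simp only: periodic_def blockwise_def if_True add.assoc)
qed

text \<open>
  The permutation is the product of the \<open>k\<close> disjoint transpositions \<open>(m i, m i + 1)\<close>, \<open>i < k\<close>;
  the induction splits off the last one.
\<close>
lemma evenperm_blockwise_transposition:
  assumes m: "2 \<le> m"
  shows "evenperm (blockwise (m * int k) m (transposition 0 1)) \<longleftrightarrow> even k"
proof (induction k)
  case 0
  have "blockwise (m * int 0) m (transposition 0 1) = id"
    by (auto simp: blockwise_def)
  then show ?case by simp
next
  case (Suc k)
  let ?b = "\<lambda>k. blockwise (m * int k) m (transposition 0 1)" and ?n = "m * int k"
  have t: "transposition 0 1 permutes {0..<m}"
    using m by (intro transposition_permutes) auto
  have n: "0 \<le> ?n"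
    using m by simp
  have p: "?b k permutes {0..<?n}"
    using m t by (intro blockwise_permutes) auto
  have step: "?b (Suc k) = transposition ?n (?n + 1) \<circ> ?b k"
  proof
    fix x
    consider "x < 0 \<or> x \<ge> ?n + m" | "x \<in> {0..<?n}" | "x \<in> {?n..<?n + m}"
      by force
    then show "?b (Suc k) x = (transposition ?n (?n + 1) \<circ> ?b k) x"
    proof cases
      case 1
      then have "x \<noteq> ?n \<and> x \<noteq> ?n + 1"
        using m n by (elim disjE) linarith+
      then show ?thesis using 1 m by (auto simp: blockwise_def algebra_simps)
    next
      case 2
      then have "?b k x \<in> {0..<?n}"
        by (simp only: permutes_in_image[OF p])
      moreover have "?b (Suc k) x = ?b k x"
        using 2 m by (auto simp: blockwise_def algebra_simps)
      ultimately show ?thesis by simp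
    next
      case 3
      have "x mod m = (x - ?n + m * int k) mod m" by simp
      also have "\<dots> = (x - ?n) mod m" by (rule mod_mult_self2)
      also have "\<dots> = x - ?n"
        using 3 by (intro mod_pos_pos_trivial) auto
      finally have "x mod m = x - ?n" .
      moreover have "0 \<le> x" using 3 n unfolding atLeastLessThan_iff by linarith
      ultimately show ?thesis using 3 m
        by (auto simp: blockwise_def periodic_transposition algebra_simps Transposition.transpose_def)
    qed
  qed
  have perm: "permutation (?b k)"
    using p by (rule permutes_imp_permutation[rotated]) simp
  have "evenperm (?b (Suc k)) \<longleftrightarrow> evenperm (transposition ?n (?n + 1)) = evenperm (?b k)"
    using evenperm_comp[OF permutation_swap_id perm, of ?n "?n + 1"] unfolding step .
  then show ?case
    unfolding Suc evenperm_swap by simp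
qed

section \<open>A 3-cycle inside one block\<close>

text \<open>
  A commutator localizes: writing the involution \<open>k\<close> as \<open>(a b) k'\<close> with \<open>k'\<close> disjoint from
  \<open>(a b)\<close>, the assumption says that \<open>c\<close> fixes the support of \<open>k'\<close> pointwise. So \<open>k'\<close> commutes
  with \<open>c\<close> and cancels from the commutator, in which only \<open>(a b)\<close> and its conjugate survive.
\<close>
lemma commutator_eq_transpositions:
  assumes c: "bij c" and k: "\<And>x. k (k x) = x" "k a = b"
    and fixed: "\<And>x. x \<notin> {a, b} \<Longrightarrow> k x \<noteq> x \<Longrightarrow> c x = x"
  shows "c \<circ> k \<circ> inv' c \<circ> k = transposition (c a) (c b) \<circ> transposition a b"
proof -
  define k' where "k' = k \<circ> transposition a b"
  have kb: "k b = a" using k by auto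
  have k'_ab: "k' a = a" "k' b = b"
    using k kb by (auto simp: k'_def)
  have k'_other: "k' x = k x" if "x \<notin> {a, b}" for x
    using that by (simp add: k'_def)
  have k_ab: "k x \<in> {a, b} \<longleftrightarrow> x \<in> {a, b}" for x
    using k kb by (metis insertE insertI1 insertI2 singletonD singletonI)
  have k'k': "k' (k' x) = x" for x
    using k'_ab k'_other[of x] k'_other[of "k x"] k_ab[of x] k(1)
    by (cases "x \<in> {a, b}") auto
  have k_eq: "k = transposition a b \<circ> k'" "k = k' \<circ> transposition a b"
  proof -
    show "k = k' \<circ> transposition a b"
      by (simp add: k'_def comp_assoc)
    show "k = transposition a b \<circ> k'"
    proof
      fix x
      show "k x = (transposition a b \<circ> k') x"
        using k'_ab k'_other[of x] k_ab[of x] k kb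
        by (cases "x \<in> {a, b}") auto
    qed
  qed
  have fixed': "c x = x" if "k' x \<noteq> x" for x
  proof -
    have "x \<notin> {a, b}" using that k'_ab by auto
    with that fixed[of x] k'_other[of x] show ?thesis by simp
  qed
  have comm: "c \<circ> k' = k' \<circ> c"
  proof
    fix x
    show "(c \<circ> k') x = (k' \<circ> c) x"
    proof (cases "k' x = x")
      case True
      have "k' (c x) = c x"
      proof (rule ccontr)
        assume "k' (c x) \<noteq> c x"
        then have "c x = x"
          using fixed'[of "c x"] c by (auto simp: bij_def inj_eq)
        with \<open>k' (c x) \<noteq> c x\<close> True show False by simp
      qed
      with True show ?thesis by simp
    next
      case False
      moreover from this have "k' (k' x) \<noteq> k' x" by (metis k'k')
      ultimately show ?thesis using fixed'[of x] fixed'[of "k' x"] by simp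
    qed
  qed
  have comm': "k' (inv' c y) = inv' c (k' y)" for y
    using fun_cong[OF comm, of "inv' c y"] c
    by (metis (mono_tags, lifting) bij_inv_eq_iff comp_apply)
  have "(c \<circ> k \<circ> inv' c \<circ> k) x = (transposition (c a) (c b) \<circ> transposition a b) x" for x
  proof -
    have "(c \<circ> k \<circ> inv' c \<circ> k) x
        = c (transposition a b (k' (inv' c (k' (transposition a b x)))))"
      using fun_cong[OF k_eq(1), of "inv' c (k x)"] fun_cong[OF k_eq(2), of x] by simp
    also have "\<dots> = (c \<circ> transposition a b \<circ> inv' c) (transposition a b x)"
      by (simp add: comm' k'k')
    finally show ?thesis
      by (simp add: conj_transposition[OF c])
  qed
  then show ?thesis by blast
qed

text \<open>
  Write \<open>g\<close> for the diagonal \<open>(0 1)\<close> modulo \<open>m\<close>, and \<open>h\<close> and \<open>k\<close> for the diagonal \<open>(1 m+1)\<close> and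
  \<open>(0 3)\<close> modulo \<open>N\<close>. The commutator \<open>c = g h g h\<close> moves a point \<open>y\<close> only if \<open>y\<close> or \<open>g y\<close> is
  congruent to \<open>1\<close> or \<open>m + 1\<close> modulo \<open>N\<close>. Such a \<open>y\<close> is never \<open>3\<close> modulo \<open>N\<close>, because \<open>g\<close> moves
  points by at most 1, and \<open>y = s N\<close> qualifies only if \<open>g\<close> moves it up, that is, if \<open>m\<close> divides
  \<open>s N\<close>, which for \<open>0 \<le> s N < L\<close> means \<open>s = 0\<close>. Hence \<open>c\<close> fixes the support of \<open>k\<close> pointwise
  except for \<open>c 0 = m\<close>, and the commutator of \<open>c\<close> with \<open>k\<close> is \<open>(m 3)(0 3)\<close>. The bounds on \<open>m\<close>
  and \<open>N\<close> keep the points involved apart.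
\<close>
lemma three_cycle_mem_of_large_modulus:
  fixes N m L :: int
  assumes G: "permutation_group {0..<L} G"
    and L: "L = lcm N m" and m: "4 \<le> m" and N: "m + 3 \<le> N"
    and GN: "\<And>p. p permutes {0..<N} \<Longrightarrow> blockwise L N p \<in> G"
    and Gm: "\<And>p. p permutes {0..<m} \<Longrightarrow> blockwise L m p \<in> G"
  shows "three_cycle m 3 0 \<in> G"
proof -
  interpret permutation_group "{0..<L}" G by (rule G)
  define g where "g = blockwise L m (transposition 0 1)"
  define h where "h = blockwise L N (transposition 1 (m + 1))"
  define k where "k = blockwise L N (transposition 0 3)"
  define c where "c = g \<circ> h \<circ> g \<circ> h"
  have mem: "g \<in> G" "h \<in> G" "k \<in> G"
    unfolding g_def h_def k_def
    using m N by (auto intro!: GN Gm transposition_permutes)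
  then have "c \<in> G" by (simp add: c_def comp_mem)
  have Lpos: "0 < L" and NL: "N dvd L" and mL: "m dvd L"
    using L m N by (auto intro: lcm_pos_int)
  have "N \<le> L" using NL Lpos by (rule zdvd_imp_le)
  have g: "g x = (if x \<notin> {0..<L} then x else if x mod m = 0 then x + 1
      else if x mod m = 1 then x - 1 else x)" for x
    by (simp add: g_def blockwise_transposition)
  have h_fix: "h x = x" if "x mod N \<notin> {1, m + 1}" for x
    using that by (simp add: h_def blockwise_transposition)
  have invol: "g (g x) = x" "k (k x) = x" for x
    unfolding g_def k_def
    using m N NL mL by (auto intro!: blockwise_transposition_involutory)
  have c_fix: "c x = x" if "x mod N \<notin> {1, m + 1}" "g x mod N \<notin> {1, m + 1}" for x
    using that by (simp add: c_def h_fix invol)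
  have residue: "(N * s + r) mod N = r" if "r \<in> {0..<N}" for s r
    using that by simp
  have c3: "c (N * s + 3) = N * s + 3" for s
  proof (rule c_fix)
    have "g (N * s + 3) \<in> {N * s + 2, N * s + 3, N * s + 4}"
      by (simp add: g)
    then show "g (N * s + 3) mod N \<notin> {1, m + 1}"
      using residue[of 2 s] residue[of 3 s] residue[of 4 s] m N by auto
  qed (use residue[of 3 s] m N in auto)
  have c0: "c (N * s) = N * s" if "N * s \<in> {0..<L}" "s \<noteq> 0" for s
  proof (rule c_fix)
    have "N * s mod m \<noteq> 0"
    proof
      assume "N * s mod m = 0"
      then have "L dvd N * s" unfolding L by (intro lcm_least) auto
      moreover have "0 < N * s" using that m N by (simp add: zero_less_mult_iff zero_le_mult_iff)
      ultimately show False using that zdvd_imp_le[of L "N * s"] by auto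
    qed
    \<comment> \<open>The point below \<open>s N\<close> has residue \<open>N - 1 > m + 1\<close> modulo \<open>N\<close>.\<close>
    then have "g (N * s) \<in> {N * (s - 1) + (N - 1), N * s}"
      by (auto simp: g algebra_simps)
    then show "g (N * s) mod N \<notin> {1, m + 1}"
      using residue[of "N - 1" "s - 1"] residue[of 0 s] m N by auto
  qed (use m in auto)
  have c00: "c 0 = m"
  proof -
    have "h 0 = 0" using m by (intro h_fix) auto
    moreover have "g 0 = 1" using Lpos by (simp add: g)
    moreover have "h 1 = m + 1"
      using m N \<open>N \<le> L\<close> by (simp add: h_def blockwise_transposition)
    moreover have "g (m + 1) = m"
      using m N \<open>N \<le> L\<close> by (simp add: g)
    ultimately show ?thesis by (simp add: c_def)
  qed
  have "c \<circ> k \<circ> inv' c \<circ> k = transposition (c 0) (c 3) \<circ> transposition 0 3"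
  proof (rule commutator_eq_transpositions)
    show "bij c" using \<open>c \<in> G\<close> permutes permutes_bij by blast
    show "k 0 = 3" using Lpos by (simp add: k_def blockwise_transposition)
    show "c x = x" if x: "x \<notin> {0, 3}" "k x \<noteq> x" for x
    proof -
      have "x \<in> {0..<L}" and r: "x mod N = 0 \<or> x mod N = 3"
        using x(2) by (auto simp: k_def blockwise_transposition split: if_splits)
      define s where "s = x div N"
      have s: "x = N * s + x mod N"
        by (simp add: s_def)
      have "0 \<le> s" using \<open>x \<in> {0..<L}\<close> m N by (simp add: s_def pos_imp_zdiv_nonneg_iff)
      then have "N * s \<in> {0..<L}"
        using s r \<open>x \<in> {0..<L}\<close> m N by auto
      with r s x show ?thesis
        using c3[of s] c0[of s] by auto
    qed
  qed (rule invol)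
  moreover have "c 3 = 3" using c3[of 0] by simp
  ultimately have "c \<circ> k \<circ> inv' c \<circ> k = three_cycle m 3 0"
    by (simp add: c00 three_cycle_def transpose_commute)
  moreover have "c \<circ> k \<circ> inv' c \<circ> k \<in> G"
    using mem \<open>c \<in> G\<close> by (simp add: comp_mem inv_mem)
  ultimately show ?thesis by simp
qed

text \<open>
  Here the blocks are too short for the commutators above. For the product of the diagonal
  transpositions \<open>(1 2)\<close> modulo 3 and \<open>(2 3)\<close> modulo 4, look at the graph whose edges are all
  their constituent transpositions on \<open>{0..<12}\<close>: two edges sharing a point multiply to a
  3-cycle, a double edge cancels, and the only isolated edge is \<open>{4, 5}\<close>. So the cube of the
  product is the transposition \<open>(4 5)\<close>, which is then conjugated into the first block.
\<close>
lemma linked_of_moduli_4_3: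
  assumes G: "permutation_group {0..<12} G"
    and G4: "\<And>p. p permutes {0..<4} \<Longrightarrow> blockwise 12 4 p \<in> G"
    and G3: "\<And>p. p permutes {0..<3} \<Longrightarrow> blockwise 12 3 p \<in> G"
  shows "permutation_group.linked G 3 2"
proof -
  interpret permutation_group "{0..<12}" G by (rule G)
  have S4: "blockwise 12 4 (transposition i j) \<in> G" if "{i, j} \<subseteq> {0..<4}" for i j
    using that by (intro G4 transposition_permutes) auto
  have S3: "blockwise 12 3 (transposition i j) \<in> G" if "{i, j} \<subseteq> {0..<3}" for i j
    using that by (intro G3 transposition_permutes) auto
  define c where "c = blockwise 12 3 (transposition 1 2) \<circ> blockwise 12 4 (transposition 2 3)"
  have "c \<in> G"
    unfolding c_def by (intro comp_mem S3 S4) auto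
  have "c \<circ> c \<circ> c = transposition 4 5"
  proof
    fix x :: int
    show "(c \<circ> c \<circ> c) x = transposition 4 5 x"
    proof (cases "x \<in> {0..<12}")
      case True
      then have "x = 0 \<or> x = 1 \<or> x = 2 \<or> x = 3 \<or> x = 4 \<or> x = 5 \<or> x = 6 \<or> x = 7 \<or>
          x = 8 \<or> x = 9 \<or> x = 10 \<or> x = 11"
        unfolding atLeastLessThan_iff by presburger
      then show ?thesis
        by (elim disjE) (simp_all add: c_def blockwise_transposition)
    next
      case False
      then show ?thesis
        by (auto simp: c_def blockwise_transposition)
    qed
  qed
  then have "transposition 4 5 \<in> G"
    using comp_mem[OF comp_mem[OF \<open>c \<in> G\<close> \<open>c \<in> G\<close>] \<open>c \<in> G\<close>] by simp
  from conj_transposition_mem[OF S3[of 0 2] this] have "transposition 4 3 \<in> G"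
    by (simp add: blockwise_transposition)
  from conj_transposition_mem[OF S4[of 2 3] this] have "transposition 4 2 \<in> G"
    by (simp add: blockwise_transposition)
  from conj_transposition_mem[OF S3[of 0 1] this] have t: "transposition 3 2 \<in> G"
    by (simp add: blockwise_transposition)
  from conj_transposition_mem[OF S4[of 1 3] this] have "transposition 2 1 \<in> G"
    by (simp add: blockwise_transposition transpose_commute)
  with t have "three_cycle 3 2 1 \<in> G"
    by (simp add: three_cycle_def comp_mem)
  then show ?thesis
    by (auto simp: linked_def intro!: exI[of _ 1])
qed

section \<open>Linking all blocks\<close>

text \<open>
  One link inside the first \<open>N\<close>-block suffices. It spreads over that block because \<open>S\<^sub>N\<close> is doubly
  transitive, and from block to block because the diagonal transposition \<open>(i i+1)\<close> modulo \<open>m\<close> with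
  \<open>i + 1\<close> congruent to \<open>s N\<close> swaps \<open>s N - 1\<close> and \<open>s N\<close>; it exists as \<open>m\<close> does not divide \<open>s N\<close>
  for \<open>0 < s N < L\<close>.
\<close>
lemma eq_symmetric_group_of_linked_in_block:
  fixes N m L :: int
  assumes G: "permutation_group {0..<L} G"
    and L: "L = lcm N m" and N: "2 \<le> N" and m: "2 \<le> m"
    and GN: "\<And>p. p permutes {0..<N} \<Longrightarrow> blockwise L N p \<in> G"
    and Gm: "\<And>p. p permutes {0..<m} \<Longrightarrow> blockwise L m p \<in> G"
    and ab: "permutation_group.linked G a b" "a \<noteq> b" "{a, b} \<subseteq> {0..<N}"
  shows "G = {p. p permutes {0..<L}}"
proof -
  interpret permutation_group "{0..<L}" G by (rule G)
  have Lpos: "0 < L" and NL: "N dvd L" and mL: "m dvd L"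
    using L m N by (auto intro: lcm_pos_int)
  have "N \<le> L" using NL Lpos by (rule zdvd_imp_le)
  obtain t where t: "L = N * t" using NL by auto
  have first_block: "blockwise L N p x = p x" if "x \<in> {0..<N}" for p x
    using that \<open>N \<le> L\<close> by (simp add: blockwise_def periodic_def)
  have link_first: "linked 0 x" if x: "x \<in> {0..<N}" for x
  proof (cases "x = 0")
    case True
    then show ?thesis by (simp add: linked_def)
  next
    case False
    \<comment> \<open>\<open>p\<close> moves \<open>a\<close> to \<open>0\<close> first and then the image of \<open>b\<close> to \<open>x\<close>.\<close>
    define p where "p = transposition (transposition a 0 b) x \<circ> transposition a 0"
    have "p permutes {0..<N}"
      unfolding p_def using ab(3) x N
      by (intro permutes_compose transposition_permutes) (auto simp: Transposition.transpose_def)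
    then have "linked (blockwise L N p a) (blockwise L N p b)"
      using linked_image[OF ab(1) GN] by blast
    moreover have "p a = 0" "p b = x"
      using ab(2) False by (auto simp: p_def Transposition.transpose_def)
    ultimately show ?thesis using ab(3) by (simp add: first_block)
  qed
  have link: "\<forall>x \<in> {0..<N * int s}. linked 0 x" if "int s \<le> t" for s
    using that
  proof (induction s)
    case 0
    then show ?case by simp
  next
    case (Suc s)
    define n where "n = N * int s"
    have "n < L"
      unfolding n_def t using Suc.prems N by (intro mult_strict_left_mono) auto
    have n_succ: "N * int (Suc s) = n + N" by (simp add: n_def algebra_simps)
    have IH: "linked 0 x" if "x \<in> {0..<n}" for x
      using Suc that by (auto simp: n_def)
    have link_n: "linked 0 n"
    proof (cases "s = 0")
      case True
      then show ?thesis by (simp add: n_def linked_def)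
    next
      case False
      have "N * 1 \<le> n" unfolding n_def using False N by (intro mult_left_mono) auto
      then have "N \<le> n" by simp
      define i where "i = n mod m - 1"
      define g where "g = blockwise L m (transposition i (i + 1))"
      have "n mod m \<noteq> 0"
      proof
        assume "n mod m = 0"
        then have "L dvd n" unfolding L n_def by (intro lcm_least) auto
        then show False using zdvd_imp_le[of L n] \<open>n < L\<close> \<open>N \<le> n\<close> N by simp
      qed
      then have i: "0 \<le> i" "i + 1 < m"
        using m pos_mod_bound[of m n] pos_mod_sign[of m n] by (auto simp: i_def)
      have "g \<in> G"
        unfolding g_def using i by (intro Gm transposition_permutes) auto
      have "(n - 1) mod m = i"
        using i by (simp add: i_def mod_diff_left_eq[of n m 1, symmetric])
      then have "g (n - 1) = n"
        using \<open>n < L\<close> \<open>N \<le> n\<close> N by (simp add: g_def blockwise_transposition)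
      moreover have "linked (g 0) (g (n - 1))"
        using \<open>N \<le> n\<close> N by (intro linked_image[OF _ \<open>g \<in> G\<close>] IH) auto
      \<comment> \<open>The link from \<open>0\<close> to \<open>n - 1\<close> is sent to one that ends at \<open>n\<close> and starts in the first block.\<close>
      moreover have "g 0 \<in> {0, 1}"
        using i Lpos m by (auto simp: g_def blockwise_transposition)
      then have "linked 0 (g 0)"
        using N by (intro link_first) auto
      ultimately show ?thesis by (metis linked_trans)
    qed
    show ?case
    proof
      fix x assume "x \<in> {0..<N * int (Suc s)}"
      then consider "x \<in> {0..<n}" | "x \<in> {n..<n + N}"
        unfolding n_succ by force
      then show "linked 0 x"
      proof cases
        case 1
        then show ?thesis by (rule IH)
      next
        case 2
        \<comment> \<open>\<open>p\<close> moves \<open>n\<close> to \<open>x\<close> within its block, and it moves \<open>0\<close> within the first block.\<close>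
        define p where "p = blockwise L N (transposition 0 (x - n))"
        have "p \<in> G"
          unfolding p_def using 2 N by (intro GN transposition_permutes) auto
        then have "linked (p 0) (p n)"
          by (rule linked_image[OF link_n])
        moreover have "p 0 = x - n" "p n = x"
          using \<open>n < L\<close> Lpos N
          by (auto simp: p_def blockwise_transposition n_def)
        ultimately show ?thesis
          using linked_trans[OF link_first[of "x - n"]] 2 by auto
      qed
    qed
  qed
  have "0 < t" using Lpos N by (simp add: t zero_less_mult_iff)
  then have link_all: "linked x y" if "x \<in> {0..<L}" "y \<in> {0..<L}" for x y
    using link[of "nat t"] that linked_sym linked_trans
    by (metis int_nat_eq order.refl t order.strict_implies_order)
  obtain u where u: "L = m * u" using mL by auto
  have "0 < u" using Lpos m by (simp add: u zero_less_mult_iff)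
  \<comment> \<open>If both quotients were even, \<open>L / 2\<close> would be a common multiple of \<open>N\<close> and \<open>m\<close>.\<close>
  have "\<not> (even t \<and> even u)"
  proof
    assume "even t \<and> even u"
    then obtain t' u' where "t = 2 * t'" "u = 2 * u'" by (elim conjE evenE)
    define M where "M = N * t'"
    have "L = 2 * M" "M = m * u'"
      using \<open>t = 2 * t'\<close> \<open>u = 2 * u'\<close> t u by (auto simp: M_def)
    have "N dvd M" unfolding M_def by (rule dvd_triv_left)
    moreover have "m dvd M" using \<open>M = m * u'\<close> by (rule dvdI)
    ultimately have "L dvd M" unfolding L by (rule lcm_least)
    then show False
      using zdvd_imp_le[of L M] \<open>L = 2 * M\<close> Lpos by linarith
  qed
  then have "\<exists>q \<in> G. \<not> evenperm q"
    using evenperm_blockwise_transposition[OF N, of "nat t"]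
      evenperm_blockwise_transposition[OF m, of "nat u"]
      GN[of "transposition 0 1"] Gm[of "transposition 0 1"]
      transposition_permutes[of 0 "{0..<N}" 1] transposition_permutes[of 0 "{0..<m}" 1]
      \<open>0 < t\<close> \<open>0 < u\<close> N m t u
    by (auto simp: even_nat_iff)
  then show ?thesis
    using eq_symmetric_group[OF _ link_all] by blast
qed

section \<open>Groups of periodic permutations of the integers\<close>

lemma BijGroup_UNIV:
  "carrier (BijGroup UNIV) = {f. bij f}"
  "bij f \<Longrightarrow> bij g \<Longrightarrow> f \<otimes>\<^bsub>BijGroup UNIV\<^esub> g = f \<circ> g"
  "\<one>\<^bsub>BijGroup UNIV\<^esub> = id"
  "bij f \<Longrightarrow> inv\<^bsub>BijGroup UNIV\<^esub> f = inv' f"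
proof -
  show "bij f \<Longrightarrow> inv\<^bsub>BijGroup UNIV\<^esub> f = inv' f"
    using inv_BijGroup[of f UNIV] by (simp add: Bij_def restrict_UNIV)
qed (auto simp: BijGroup_def Bij_def compose_def fun_eq_iff)

lemma permutation_group_UNIV_iff: "permutation_group UNIV H \<longleftrightarrow> subgroup H (BijGroup UNIV)"
proof
  assume "permutation_group UNIV H"
  then interpret permutation_group UNIV H .
  have bij: "bij p" if "p \<in> H" for p
    using permutes[OF that] by (rule permutes_bij)
  show "subgroup H (BijGroup UNIV)"
    by (rule subgroup.intro) (auto simp: BijGroup_UNIV bij id_mem comp_mem inv_mem)
next
  assume "subgroup H (BijGroup UNIV)"
  then interpret H: subgroup H "BijGroup UNIV" .
  have bij: "bij p" if "p \<in> H" for p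
    using H.subset that by (auto simp: BijGroup_UNIV)
  show "permutation_group UNIV H"
  proof
    show "p permutes UNIV" if "p \<in> H" for p
      using bij[OF that] by (intro bij_imp_permutes) auto
    show "id \<in> H" using H.one_closed by (simp add: BijGroup_UNIV)
    show "p \<circ> q \<in> H" if "p \<in> H" "q \<in> H" for p q
      using H.m_closed[OF that] that by (simp add: BijGroup_UNIV bij)
    show "inv' p \<in> H" if "p \<in> H" for p
      using H.m_inv_closed[OF that] that by (simp add: BijGroup_UNIV bij)
  qed
qed

definition periodic_group :: "int \<Rightarrow> (int \<Rightarrow> int) set" where
  "periodic_group m = periodic m ` {p. p permutes {0..<m}}"

lemma permutation_group_periodic_group:
  assumes "0 < m"
  shows "permutation_group UNIV (periodic_group m)"
proof
  show "f permutes UNIV" if "f \<in> periodic_group m" for f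
    using that bij_periodic[OF assms]
    by (intro bij_imp_permutes) (auto simp: periodic_group_def)
  show "id \<in> periodic_group m"
    unfolding periodic_group_def using periodic_id permutes_id by (metis imageI mem_Collect_eq)
  show "f \<circ> g \<in> periodic_group m" if "f \<in> periodic_group m" "g \<in> periodic_group m" for f g
    using that assms unfolding periodic_group_def
    by (auto simp: periodic_comp[symmetric] intro!: imageI permutes_compose)
  show "inv' f \<in> periodic_group m" if "f \<in> periodic_group m" for f
    using that assms unfolding periodic_group_def
    by (auto simp: inv_periodic intro!: imageI permutes_inv)
qed

lemma periodic_group_mono:
  assumes "0 < m" "0 < L" "m dvd L"
  shows "periodic_group m \<subseteq> periodic_group L"
  unfolding periodic_group_def
  using periodic_blockwise[OF assms] blockwise_permutes[OF assms(1,3)]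
  by (metis (no_types, lifting) image_subsetI imageI mem_Collect_eq)

text \<open>
  Pulling a group of permutations of the integers back along \<open>periodic L\<close> is what allows arguments
  with parity and 3-cycles, which need finite support.
\<close>
lemma permutation_group_vimage_periodic:
  assumes "permutation_group UNIV H" "0 < L"
  shows "permutation_group {0..<L} {p. p permutes {0..<L} \<and> periodic L p \<in> H}"
proof -
  interpret H: permutation_group UNIV H by (rule assms(1))
  show ?thesis
  proof
    show "id \<in> {p. p permutes {0..<L} \<and> periodic L p \<in> H}"
      using H.id_mem periodic_id[of L] by (simp add: permutes_id)
  qed (auto simp: periodic_comp assms(2) H.comp_mem permutes_compose permutes_inv
      inv_periodic[symmetric] H.inv_mem)
qed

lemma lcm_4_3: "lcm 4 3 = (12::int)"
  by code_simp

lemma periodic_group_lcm_subset: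
  fixes N m :: int
  assumes H: "permutation_group UNIV H"
    and sub: "periodic_group N \<subseteq> H" "periodic_group m \<subseteq> H"
    and size: "4 \<le> m \<and> m + 3 \<le> N \<or> N = 4 \<and> m = 3"
  shows "periodic_group (lcm N m) \<subseteq> H"
proof -
  define L where "L = lcm N m"
  define G where "G = {p. p permutes {0..<L} \<and> periodic L p \<in> H}"
  have pos: "2 \<le> N" "2 \<le> m" using size by auto
  then have "0 < L" by (auto simp: L_def intro: lcm_pos_int)
  have G: "permutation_group {0..<L} G"
    unfolding G_def using H \<open>0 < L\<close> by (rule permutation_group_vimage_periodic)
  have mem: "blockwise L k p \<in> G"
    if "periodic_group k \<subseteq> H" "0 < k" "k dvd L" "p permutes {0..<k}" for k p
    using that \<open>0 < L\<close> by (auto simp: G_def blockwise_permutes periodic_blockwise periodic_group_def)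
  have GN: "blockwise L N p \<in> G" if "p permutes {0..<N}" for p
    using mem[OF sub(1)] pos that by (simp add: L_def)
  have Gm: "blockwise L m p \<in> G" if "p permutes {0..<m}" for p
    using mem[OF sub(2)] pos that by (simp add: L_def)
  have "\<exists>a b. permutation_group.linked G a b \<and> a \<noteq> b \<and> {a, b} \<subseteq> {0..<N}"
  proof (cases "N = 4 \<and> m = 3")
    case True
    have "L = 12" using True unfolding L_def using lcm_4_3 by simp
    then have "permutation_group.linked G 3 2"
      using linked_of_moduli_4_3[of G] G GN Gm True by simp
    then show ?thesis using True by (intro exI[of _ 3] exI[of _ 2]) auto
  next
    case False
    then have m: "4 \<le> m" "m + 3 \<le> N" using size by auto
    then have "three_cycle m 3 0 \<in> G"
      by (intro three_cycle_mem_of_large_modulus[OF G L_def _ _ GN Gm])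
    then have "permutation_group.linked G m 3"
      using m by (auto simp: permutation_group.linked_def[OF G] intro!: exI[of _ 0])
    then show ?thesis using m by (intro exI[of _ m] exI[of _ 3]) auto
  qed
  then have "G = {p. p permutes {0..<L}}"
    using eq_symmetric_group_of_linked_in_block[OF G L_def pos GN Gm] by blast
  then show ?thesis
    by (auto simp: periodic_group_def G_def L_def)
qed

text \<open>
  The coprime numbers \<open>n\<close> and \<open>n - 1\<close> both divide the least common multiple. The bound is the
  size condition \<open>N \<ge> m + 3\<close> for the next modulus \<open>m = n + 1\<close>.
\<close>
lemma Lcm_upto_ge:
  assumes "4 \<le> n"
  shows "n + 4 \<le> Lcm {2..n::nat}"
proof -
  obtain k where k: "n = Suc k" using assms by (cases n) auto
  have "n * k dvd Lcm {2..n}"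
    using assms by (intro divides_mult dvd_Lcm) (auto simp: k)
  moreover have "0 < Lcm {2..n}"
    by (intro Nat.gr0I) (auto simp: Lcm_0_iff)
  ultimately have "n * k \<le> Lcm {2..n}" by (rule dvd_imp_le)
  moreover have "n * 3 \<le> n * k" using assms by (intro mult_left_mono) (auto simp: k)
  ultimately show ?thesis using assms by linarith
qed

lemma periodic_group_Lcm_subset:
  assumes H: "permutation_group UNIV H" and n: "4 \<le> n"
    and sub: "\<And>m. m \<in> {2..n} \<Longrightarrow> periodic_group (int m) \<subseteq> H"
  shows "periodic_group (int (Lcm {2..n})) \<subseteq> H"
  using n sub
proof (induction n rule: nat_induct_at_least)
  case base
  have "{2..4::nat} = {2, 3, 4}" by auto
  then have "Lcm {2..4::nat} = lcm 2 (lcm 3 4)" by simp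
  moreover have "lcm 2 (lcm 3 4) = (12::nat)" by code_simp
  ultimately show ?case
    using periodic_group_lcm_subset[OF H, of 4 3] lcm_4_3 base[of 3] base[of 4] by simp
next
  case (Suc n)
  have "int (Lcm {2..Suc n}) = lcm (int (Lcm {2..n})) (int (Suc n))"
    using Suc.hyps by (simp add: atLeastAtMostSuc_conv lcm.commute del: of_nat_Suc)
  moreover have "periodic_group (lcm (int (Lcm {2..n})) (int (Suc n))) \<subseteq> H"
  proof (rule periodic_group_lcm_subset[OF H])
    show "periodic_group (int (Lcm {2..n})) \<subseteq> H"
      using Suc by simp
    show "periodic_group (int (Suc n)) \<subseteq> H"
      using Suc by (intro Suc.prems) simp
    show "4 \<le> int (Suc n) \<and> int (Suc n) + 3 \<le> int (Lcm {2..n})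
        \<or> int (Lcm {2..n}) = 4 \<and> int (Suc n) = 3"
      using Lcm_upto_ge[OF Suc.hyps(1)] Suc.hyps(1) by linarith
  qed
  ultimately show ?case by simp
qed

section \<open>Identification of the class transposition groups\<close>

lemma horizontal_class_transposition_eq_periodic:
  assumes "r1 < m" "r2 < m"
  shows "horizontal_class_transposition m r1 r2
    = periodic (int m) (transposition (int r1) (int r2))"
  using assms
  by (auto simp: fun_eq_iff horizontal_class_transposition_def periodic_transposition residue_class_iff)

lemma carrier_CT:
  assumes "0 < m"
  shows "carrier (CT m) = periodic_group (int m)"
proof
  let ?T = "{horizontal_class_transposition m r1 r2 | r1 r2. r1 < m \<and> r2 < m \<and> r1 \<noteq> r2}"
  interpret B: group "BijGroup UNIV" by (rule group_BijGroup)
  have T: "?T \<subseteq> carrier (BijGroup UNIV)"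
    using horizontal_class_transposition_in_BijGroup by auto
  then have carrier: "carrier (CT m) = generate (BijGroup UNIV) ?T"
    by (simp add: CT_def carrier_subgroup_generated Int_absorb1)
  have "?T \<subseteq> periodic_group (int m)"
    by (auto simp: horizontal_class_transposition_eq_periodic periodic_group_def
        intro!: imageI transposition_permutes)
  then show "carrier (CT m) \<subseteq> periodic_group (int m)"
    unfolding carrier
    using permutation_group_periodic_group[of "int m"] assms
    by (intro B.generate_subgroup_incl) (simp_all add: permutation_group_UNIV_iff)
  interpret C: permutation_group UNIV "carrier (CT m)"
    unfolding permutation_group_UNIV_iff carrier using T by (rule B.generate_is_subgroup)
  have "periodic (int m) p \<in> carrier (CT m)" if "p permutes {0..<int m}" for p
    using that finite_atLeastLessThan_int
  proof (induction rule: permutes_induct)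
    case id
    show ?case using C.id_mem periodic_id[of "int m"] by (simp add: id_def)
  next
    case (swap a b p)
    have "horizontal_class_transposition m (nat a) (nat b) \<in> ?T"
      using swap(1-3) by (intro CollectI exI[of _ "nat a"] exI[of _ "nat b"]) auto
    then have "horizontal_class_transposition m (nat a) (nat b) \<in> carrier (CT m)"
      unfolding carrier by (rule generate.incl)
    then have "periodic (int m) (transposition a b) \<in> carrier (CT m)"
      using horizontal_class_transposition_eq_periodic[of "nat a" m "nat b"] swap(1,2)
      by (simp add: nat_less_iff)
    then show ?case
      using C.comp_mem[OF _ swap.IH] assms
      by (simp only: periodic_comp[OF _ swap.hyps(4)] of_nat_0_less_iff)
  qed
  then show "periodic_group (int m) \<subseteq> carrier (CT m)"
    by (auto simp: periodic_group_def)
qed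

lemma carrier_CT_upto:
  assumes "4 \<le> n"
  shows "carrier (CT_upto n) = periodic_group (int (Lcm {2..n}))"
proof
  let ?N = "Lcm {2..n}" and ?S = "\<Union>m\<in>{2..n}. carrier (CT m)"
  interpret B: group "BijGroup UNIV" by (rule group_BijGroup)
  have S: "?S = (\<Union>m\<in>{2..n}. periodic_group (int m))"
    by (auto simp: carrier_CT)
  have "?S \<subseteq> carrier (BijGroup UNIV)"
    unfolding S by (auto simp: BijGroup_UNIV periodic_group_def intro!: bij_periodic)
  then have carrier: "carrier (CT_upto n) = generate (BijGroup UNIV) ?S"
    by (simp add: CT_upto_def carrier_subgroup_generated Int_absorb1)
  have "0 < ?N" using Lcm_upto_ge[OF assms] assms by simp
  then have "?S \<subseteq> periodic_group (int ?N)"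
    unfolding S by (intro UN_least periodic_group_mono) auto
  then show "carrier (CT_upto n) \<subseteq> periodic_group (int ?N)"
    unfolding carrier using permutation_group_periodic_group[of "int ?N"] \<open>0 < ?N\<close>
    by (intro B.generate_subgroup_incl) (simp_all add: permutation_group_UNIV_iff)
  have "permutation_group UNIV (carrier (CT_upto n))"
    unfolding permutation_group_UNIV_iff carrier
    using \<open>?S \<subseteq> carrier (BijGroup UNIV)\<close> by (rule B.generate_is_subgroup)
  then show "periodic_group (int ?N) \<subseteq> carrier (CT_upto n)"
    using assms
  proof (rule periodic_group_Lcm_subset)
    show "periodic_group (int m) \<subseteq> carrier (CT_upto n)" if "m \<in> {2..n}" for m
      unfolding carrier S using that by (auto intro!: generate.incl)
  qed
qed

lemma inj_on_periodic:
  assumes "0 < m"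
  shows "inj_on (periodic m) {p. p permutes {0..<m}}"
proof (rule inj_onI, safe)
  fix p q assume p: "p permutes {0..<m}" and q: "q permutes {0..<m}"
    and eq: "periodic m p = periodic m q"
  show "p = q"
  proof
    fix x
    show "p x = q x"
    proof (cases "x \<in> {0..<m}")
      case True
      then show ?thesis using fun_cong[OF eq, of x] by (simp add: periodic_def)
    next
      case False
      then show ?thesis using p q by (metis permutes_not_in)
    qed
  qed
qed

theorem theorem1p2:
  fixes n N :: nat
  assumes "n > 3"
    and "N = Lcm {2..n}"
  shows "CT_upto n \<cong> sym_group N"
proof -
  have n: "4 \<le> n" using assms(1) by simp
  then have "0 < N" using Lcm_upto_ge[OF n] assms(2) by simp
  \<comment> \<open>\<open>F\<close> transports permutations along the shift from \<open>{1..N}\<close> to \<open>{0..<N}\<close>.\<close>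
  define f :: "nat \<Rightarrow> int" where "f k = int k - 1" for k
  define F where "F \<sigma> x = (if x \<in> {0..<int N} then f (\<sigma> (inv_into {1..N} f x)) else x)" for \<sigma> x
  have f: "bij_betw f {1..N} {0..<int N}"
    by (rule bij_betw_byWitness[of _ "\<lambda>x. nat (x + 1)"]) (auto simp: f_def)
  have F: "bij_betw F {\<sigma>. \<sigma> permutes {1..N}} {p. p permutes {0..<int N}}"
    using bij_betw_permutations[OF f] unfolding F_def .
  have F_comp: "F (\<sigma> \<circ> \<rho>) = F \<sigma> \<circ> F \<rho>" if "\<rho> permutes {1..N}" for \<sigma> \<rho>
  proof
    fix x
    show "F (\<sigma> \<circ> \<rho>) x = (F \<sigma> \<circ> F \<rho>) x"
    proof (cases "x \<in> {0..<int N}")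
      case True
      then have "inv_into {1..N} f x \<in> {1..N}"
        using f by (metis bij_betw_def inv_into_into)
      then have "\<rho> (inv_into {1..N} f x) \<in> {1..N}"
        by (simp only: permutes_in_image[OF that])
      then have "f (\<rho> (inv_into {1..N} f x)) \<in> {0..<int N}"
        "inv_into {1..N} f (f (\<rho> (inv_into {1..N} f x))) = \<rho> (inv_into {1..N} f x)"
        using f by (auto simp: bij_betw_def)
      then show ?thesis
        by (simp only: F_def True if_True comp_apply)
    next
      case False
      then show ?thesis by (simp only: F_def if_False comp_apply)
    qed
  qed
  have carrier: "carrier (CT_upto n) = periodic (int N) ` {p. p permutes {0..<int N}}"
    using carrier_CT_upto[OF n] assms(2) by (simp add: periodic_group_def)
  have bij: "bij_betw (\<lambda>\<sigma>. periodic (int N) (F \<sigma>)) (carrier (sym_group N)) (carrier (CT_upto n))"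
  proof -
    have "bij_betw (periodic (int N)) {p. p permutes {0..<int N}} (carrier (CT_upto n))"
      unfolding carrier using inj_on_periodic[of "int N"] \<open>0 < N\<close> by (simp add: inj_on_imp_bij_betw)
    from bij_betw_trans[OF F this] show ?thesis
      by (simp add: sym_group_def comp_def)
  qed
  have "(\<lambda>\<sigma>. periodic (int N) (F \<sigma>)) \<in> hom (sym_group N) (CT_upto n)"
  proof (rule homI)
    fix \<sigma> \<rho> assume "\<sigma> \<in> carrier (sym_group N)" "\<rho> \<in> carrier (sym_group N)"
    then have perm: "\<rho> permutes {1..N}" "F \<sigma> permutes {0..<int N}" "F \<rho> permutes {0..<int N}"
      using F by (auto simp: sym_group_def bij_betw_def)
    then have "periodic (int N) (F \<sigma>) \<otimes>\<^bsub>CT_upto n\<^esub> periodic (int N) (F \<rho>)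
        = periodic (int N) (F \<sigma>) \<circ> periodic (int N) (F \<rho>)"
      using \<open>0 < N\<close> by (simp add: CT_upto_def BijGroup_UNIV bij_periodic)
    then show "periodic (int N) (F (\<sigma> \<otimes>\<^bsub>sym_group N\<^esub> \<rho>))
        = periodic (int N) (F \<sigma>) \<otimes>\<^bsub>CT_upto n\<^esub> periodic (int N) (F \<rho>)"
      using perm \<open>0 < N\<close> by (simp add: sym_group_def F_comp periodic_comp)
  qed (use bij in \<open>auto simp: bij_betw_def\<close>)
  with bij have "sym_group N \<cong> CT_upto n"
    by (auto simp: is_iso_def iso_def)
  then show ?thesis
    by (rule group.iso_sym[OF sym_group_is_group])
qed

end
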